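(* Let $h:\mathbb{R}^m\to\mathbb{R}$ be $(\kappa,\gamma)$-strongly quasar-convex with respect to $\overline{y}\in\arg\min_{\mathbb{R}^m}h$, where $\kappa\in(0,1]$ and $\gamma\ge 0$, and let $A:\mathbb{R}^n\to\mathbb{R}^m$ be a linear operator. Define $g:=h\circ A$. Then the following assertions hold: (a) If $\overline{y}\in\mathcal{R}(A)$, then there exists $\overline{x}\in\mathbb{R}^n$ such that $A\overline{x}=\overline{y}$, and for every $x\in\overline{x}+\mathcal{R}(A^\top)$ and every $\lambda\in[0,1]$, $$g(\lambda\overline{x}+(1-\lambda)x)\le\kappa\lambda g(\overline{x})+(1-\kappa\lambda)g(x)-\lambda\left(1-\frac{\lambda}{2-\kappa}\right)\frac{\kappa\gamma\sigma_{\min}^2(A)}{2}\|x-\overline{x}\|^2.$$ (b) If, in addition, $A$ has full column rank and $\overline{y}\in\mathcal{R}(A)$, then $g$ is $(\kappa,\gamma\sigma_{\min}^2(A))$-strongly quasar-convex on $\mathbb{R}^n$ with respect to $\overline{x}$.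
   Context: $\mathcal{R}(A)$ denotes the range of $A$ and $\sigma_{\min}(A)$ its smallest nonzero singular value; $\|\cdot\|$ is the Euclidean norm. Let $\kappa\in(0,1]$, $\gamma\ge 0$. A function $h:\mathbb{R}^n\to\mathbb{R}$ with $\arg\min_{\mathbb{R}^n}h\neq\emptyset$ is called $(\kappa,\gamma)$-strongly quasar-convex with respect to $\overline{x}\in\arg\min_{\mathbb{R}^n}h$ if for all $x\in\mathbb{R}^n$ and all $\lambda\in[0,1]$, $$h(\lambda\overline{x}+(1-\lambda)x)\le\kappa\lambda h(\overline{x})+(1-\kappa\lambda)h(x)-\lambda\left(1-\frac{\lambda}{2-\kappa}\right)\frac{\kappa\gamma}{2}\|x-\overline{x}\|^2.$$ *)

theory Defs
  imports "HOL-Analysis.Analysis"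
begin

definition strongly_quasar_convex ::
  "real \<Rightarrow> real \<Rightarrow> ('a::euclidean_space \<Rightarrow> real) \<Rightarrow> 'a \<Rightarrow> bool" where
  "strongly_quasar_convex \<kappa> \<gamma> h xbar \<longleftrightarrow>
     0 < \<kappa> \<and> \<kappa> \<le> 1 \<and> 0 \<le> \<gamma> \<and> is_arg_min h (\<lambda>_. True) xbar \<and>
     (\<forall>x. \<forall>t\<in>{0..1}.
        h (t *\<^sub>R xbar + (1 - t) *\<^sub>R x)
          \<le> \<kappa> * t * h xbar + (1 - \<kappa> * t) * h x
             - t * (1 - t / (2 - \<kappa>)) * (\<kappa> * \<gamma> / 2) * (norm (x - xbar))\<^sup>2)"

text \<open>The positive singular values of \<open>A\<close> are the square roots of the positive
  eigenvalues of \<open>A\<^sup>T A\<close>.\<close>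

definition nonzero_singular_values ::
  "('a::euclidean_space \<Rightarrow> 'b::euclidean_space) \<Rightarrow> real set" where
  "nonzero_singular_values A =
     {s. 0 < s \<and> (\<exists>v. v \<noteq> 0 \<and> adjoint A (A v) = s\<^sup>2 *\<^sub>R v)}"

text \<open>For \<open>A = 0\<close> there is no nonzero singular value, and the value below is unspecified.\<close>

definition sigma_min :: "('a::euclidean_space \<Rightarrow> 'b::euclidean_space) \<Rightarrow> real" where
  "sigma_min A = Min (nonzero_singular_values A)"

text \<open>\<^const>\<open>Min\<close> is the true minimum only on finite sets.\<close>

lemma finite_nonzero_singular_values:
  fixes A :: "'a::euclidean_space \<Rightarrow> 'b::euclidean_space"
  assumes "linear A"
  shows "finite (nonzero_singular_values A)"
proof -
  let ?S = "nonzero_singular_values A"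
  have "\<forall>s\<in>?S. \<exists>v. v \<noteq> 0 \<and> adjoint A (A v) = s\<^sup>2 *\<^sub>R v"
    by (auto simp: nonzero_singular_values_def)
  then obtain v where v: "\<And>s. s \<in> ?S \<Longrightarrow> v s \<noteq> 0 \<and> adjoint A (A (v s)) = s\<^sup>2 *\<^sub>R v s"
    by metis
  have pos: "0 < s" if "s \<in> ?S" for s
    using that by (simp add: nonzero_singular_values_def)
  have orth: "v s \<bullet> v r = 0" if s: "s \<in> ?S" and r: "r \<in> ?S" and "s \<noteq> r" for s r
  proof -
    have "adjoint A (A (v s)) \<bullet> v r = v s \<bullet> adjoint A (A (v r))"
      by (simp add: adjoint_works[OF assms] adjoint_clauses[OF assms])
    then have "s\<^sup>2 * (v s \<bullet> v r) = r\<^sup>2 * (v s \<bullet> v r)"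
      using v[OF s] v[OF r] by simp
    moreover have "s\<^sup>2 \<noteq> r\<^sup>2"
      using pos[OF s] pos[OF r] \<open>s \<noteq> r\<close> by (simp add: power2_eq_iff_nonneg less_imp_le)
    ultimately show ?thesis by simp
  qed
  have "inj_on v ?S"
    by (rule inj_onI) (metis orth v inner_eq_zero_iff)
  moreover have "finite (v ` ?S)"
  proof (rule pairwise_orthogonal_imp_finite)
    show "pairwise orthogonal (v ` ?S)"
      by (auto simp: pairwise_def orthogonal_def intro: orth)
  qed
  ultimately show ?thesis
    using finite_imageD by blast
qed

end

theory Submission
  imports Defs
begin

text \<open>
  Everything rests on one spectral estimate: \<open>\<sigma>\<^sub>m\<^sub>i\<^sub>n(A) \<parallel>x\<parallel> \<le> \<parallel>A x\<parallel>\<close> for every \<open>x\<close> in the range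
  of \<open>A\<^sup>T\<close>. To prove it without the spectral theorem, let \<open>v\<close> minimise \<open>\<parallel>A x\<parallel>\<^sup>2\<close> over the unit
  sphere of \<open>range A\<^sup>T\<close>, with minimum value \<open>\<mu>\<close>. The quadratic form
  \<open>q x = \<parallel>A x\<parallel>\<^sup>2 - \<mu> \<parallel>x\<parallel>\<^sup>2\<close> is nonnegative on \<open>range A\<^sup>T\<close> and vanishes at \<open>v\<close>, so \<open>v\<close> lies in
  its kernel, that is, \<open>A\<^sup>T A v = \<mu> v\<close>. Moreover \<open>\<mu> > 0\<close> because \<open>A\<close> is injective on
  \<open>range A\<^sup>T\<close>. Hence \<open>sqrt \<mu>\<close> is a nonzero singular value and \<open>\<sigma>\<^sub>m\<^sub>i\<^sub>n(A)\<^sup>2 \<le> \<mu>\<close>.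

  Given any preimage \<open>z\<close> of the minimiser \<open>y\<close> of \<open>h\<close>, the inequality for \<open>h\<close> at \<open>A x\<close> is the
  desired inequality for \<open>h \<circ> A\<close> at \<open>x\<close> with \<open>\<gamma> \<parallel>A (x - z)\<parallel>\<^sup>2\<close> in place of
  \<open>\<gamma> \<sigma>\<^sub>m\<^sub>i\<^sub>n(A)\<^sup>2 \<parallel>x - z\<parallel>\<^sup>2\<close>. Its factor \<open>t (1 - t / (2 - \<kappa>))\<close> is nonnegative since
  \<open>t \<le> 1 \<le> 2 - \<kappa>\<close>, so the estimate applies whenever \<open>x - z\<close> is in \<open>range A\<^sup>T\<close>. If \<open>A\<close> has full
  column rank, then \<open>range A\<^sup>T\<close> is the whole space.
\<close>

lemma norm_diff_scaleR_squared:
  fixes a b :: "'a::real_inner"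
  shows "(norm (a - e *\<^sub>R b))\<^sup>2 = (norm a)\<^sup>2 - 2 * e * (a \<bullet> b) + e\<^sup>2 * (norm b)\<^sup>2"
  unfolding power2_norm_eq_inner
  by (simp add: inner_diff inner_commute power2_eq_square algebra_simps)

lemma adjoint_eigenvector_of_minimiser:
  fixes A :: "'a::euclidean_space \<Rightarrow> 'b::euclidean_space"
  assumes A: "linear A"
    and W: "subspace W" "v \<in> W" "adjoint A (A v) \<in> W"
    and min: "\<And>x. x \<in> W \<Longrightarrow> \<mu> * (norm x)\<^sup>2 \<le> (norm (A x))\<^sup>2"
    and eq: "(norm (A v))\<^sup>2 = \<mu> * (norm v)\<^sup>2"
  shows "adjoint A (A v) = \<mu> *\<^sub>R v"
proof -
  define w where "w = adjoint A (A v) - \<mu> *\<^sub>R v"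
  define q where "q = (norm (A w))\<^sup>2 - \<mu> * (norm w)\<^sup>2"
  have w: "w \<in> W"
    unfolding w_def using W by (simp add: subspace_diff subspace_scale)
  have AvAw: "A v \<bullet> A w = (norm w)\<^sup>2 + \<mu> * (v \<bullet> w)"
  proof -
    have "w \<bullet> w = adjoint A (A v) \<bullet> w - \<mu> * (v \<bullet> w)"
      by (metis w_def inner_diff_left inner_scaleR_left)
    then show ?thesis
      by (simp add: power2_norm_eq_inner adjoint_clauses(2)[OF A])
  qed
  \<comment> \<open>Moving from \<open>v\<close> in the direction \<open>- w\<close> changes the form by \<open>- 2 e \<parallel>w\<parallel>\<^sup>2 + e\<^sup>2 q\<close>.\<close>
  have key: "2 * e * (norm w)\<^sup>2 \<le> e\<^sup>2 * q" for e
  proof -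
    have "v - e *\<^sub>R w \<in> W"
      using W w by (simp add: subspace_diff subspace_scale)
    from min[OF this]
    have "\<mu> * (norm (v - e *\<^sub>R w))\<^sup>2 \<le> (norm (A v - e *\<^sub>R A w))\<^sup>2"
      by (simp add: linear_diff[OF A] linear_scale[OF A])
    then have "\<mu> * ((norm v)\<^sup>2 - 2 * e * (v \<bullet> w) + e\<^sup>2 * (norm w)\<^sup>2)
        \<le> (norm (A v))\<^sup>2 - 2 * e * (A v \<bullet> A w) + e\<^sup>2 * (norm (A w))\<^sup>2"
      by (simp only: norm_diff_scaleR_squared)
    then show ?thesis
      unfolding q_def eq AvAw by (simp add: algebra_simps)
  qed
  have "q \<ge> 0"
    unfolding q_def using min[OF w] by simp
  have "(norm w)\<^sup>2 \<le> 0"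
  proof (cases "q = 0")
    case True
    then show ?thesis using key[of 1] by simp
  next
    case False
    with \<open>q \<ge> 0\<close> have "q > 0" by simp
    \<comment> \<open>This \<open>e\<close> minimises \<open>- 2 e \<parallel>w\<parallel>\<^sup>2 + e\<^sup>2 q\<close>.\<close>
    have "2 * ((norm w)\<^sup>2 / q) * (norm w)\<^sup>2 \<le> ((norm w)\<^sup>2 / q)\<^sup>2 * q"
      by (rule key)
    then have "2 * ((norm w)\<^sup>2)\<^sup>2 \<le> ((norm w)\<^sup>2)\<^sup>2"
      using \<open>q > 0\<close> by (simp add: power2_eq_square field_simps)
    then show ?thesis by simp
  qed
  then show ?thesis by (simp add: w_def)
qed

text \<open>For \<open>A = 0\<close> the left-hand side involves the unspecified minimum of the empty set, but then
  \<open>range A\<^sup>T\<close> is trivial.\<close>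

lemma sigma_min_le_norm:
  fixes A :: "'a::euclidean_space \<Rightarrow> 'b::euclidean_space"
  assumes A: "linear A" and x: "x \<in> range (adjoint A)"
  shows "(sigma_min A)\<^sup>2 * (norm x)\<^sup>2 \<le> (norm (A x))\<^sup>2"
proof (cases "x = 0")
  case True
  then show ?thesis by simp
next
  case False
  define W where "W = range (adjoint A)"
  define S where "S = sphere 0 1 \<inter> W"
  have W: "subspace W"
    unfolding W_def by (simp add: linear_subspace_image[OF adjoint_linear[OF A]])
  have normalised: "(1 / norm y) *\<^sub>R y \<in> S" if "y \<in> W" "y \<noteq> 0" for y
    using that W by (simp add: S_def subspace_scale)
  have "compact S"
    unfolding S_def by (intro compact_Int_closed compact_sphere closed_subspace W)
  moreover have "S \<noteq> {}"
    using normalised[of x] x False by (auto simp: W_def)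
  moreover have "continuous_on S (\<lambda>y. (norm (A y))\<^sup>2)"
    by (intro continuous_intros linear_continuous_on linear_conv_bounded_linear[THEN iffD1] A)
  ultimately obtain v where v: "v \<in> S"
    and v_min: "\<And>y. y \<in> S \<Longrightarrow> (norm (A v))\<^sup>2 \<le> (norm (A y))\<^sup>2"
    using continuous_attains_inf[of S "\<lambda>y. (norm (A y))\<^sup>2"] by blast
  define \<mu> where "\<mu> = (norm (A v))\<^sup>2"
  have vW: "v \<in> W" and nv: "norm v = 1"
    using v by (auto simp: S_def)
  have min: "\<mu> * (norm y)\<^sup>2 \<le> (norm (A y))\<^sup>2" if "y \<in> W" for y
  proof (cases "y = 0")
    case True
    then show ?thesis by simp
  next
    case False
    have "\<mu> \<le> (norm (A ((1 / norm y) *\<^sub>R y)))\<^sup>2"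
      unfolding \<mu>_def by (rule v_min[OF normalised[OF that False]])
    also have "\<dots> = (norm (A y))\<^sup>2 / (norm y)\<^sup>2"
      by (simp add: linear_scale[OF A] power_divide)
    finally show ?thesis
      using False by (simp add: field_simps)
  qed
  have "A v \<noteq> 0"
  proof
    assume "A v = 0"
    moreover obtain u where "v = adjoint A u"
      using vW by (auto simp: W_def)
    ultimately have "v \<bullet> v = 0"
      by (metis adjoint_clauses(2)[OF A] inner_zero_right)
    then show False using nv by auto
  qed
  then have "\<mu> > 0" by (simp add: \<mu>_def)
  have "adjoint A (A v) = \<mu> *\<^sub>R v"
    by (rule adjoint_eigenvector_of_minimiser[OF A W vW _ min])
      (auto simp: W_def \<mu>_def nv)
  then have sv: "sqrt \<mu> \<in> nonzero_singular_values A"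
    using \<open>\<mu> > 0\<close> nv by (auto simp: nonzero_singular_values_def intro!: exI[of _ v])
  note fin = finite_nonzero_singular_values[OF A]
  have "sigma_min A \<le> sqrt \<mu>"
    unfolding sigma_min_def by (rule Min_le[OF fin sv])
  moreover have "sigma_min A \<in> nonzero_singular_values A"
    unfolding sigma_min_def using Min_in[OF fin] sv by blast
  then have "0 < sigma_min A"
    by (simp add: nonzero_singular_values_def)
  ultimately have "(sigma_min A)\<^sup>2 \<le> (sqrt \<mu>)\<^sup>2"
    by (intro power_mono) auto
  then have "(sigma_min A)\<^sup>2 \<le> \<mu>"
    using \<open>\<mu> > 0\<close> by simp
  then have "(sigma_min A)\<^sup>2 * (norm x)\<^sup>2 \<le> \<mu> * (norm x)\<^sup>2"
    by (rule mult_right_mono) simp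
  also have "\<dots> \<le> (norm (A x))\<^sup>2"
    using min x by (simp add: W_def)
  finally show ?thesis .
qed

lemma surj_adjoint_if_full_column_rank:
  fixes A :: "real ^ 'n \<Rightarrow> real ^ 'm"
  assumes "linear A" and "rank (matrix A) = CARD('n)"
  shows "surj (adjoint A)"
proof -
  have "rank (transpose (matrix A)) = CARD('n)"
    using assms(2) by (simp add: rank_transpose)
  then have "surj ((*v) (transpose (matrix A)))"
    by (simp add: full_rank_surjective)
  moreover have "adjoint A = (*v) (transpose (matrix A))"
    using adjoint_matrix[of "matrix A"] assms(1) by (simp add: fun_eq_iff)
  ultimately show ?thesis by simp
qed

lemma strongly_quasar_convex_compose_linear:
  fixes A :: "'a::euclidean_space \<Rightarrow> 'b::euclidean_space"
  assumes h: "strongly_quasar_convex \<kappa> \<gamma> h (A z)"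
    and A: "linear A"
    and x: "x - z \<in> range (adjoint A)"
    and t: "t \<in> {0..1}"
  shows "h (A (t *\<^sub>R z + (1 - t) *\<^sub>R x))
    \<le> \<kappa> * t * h (A z) + (1 - \<kappa> * t) * h (A x)
       - t * (1 - t / (2 - \<kappa>)) * (\<kappa> * \<gamma> * (sigma_min A)\<^sup>2 / 2) * (norm (x - z))\<^sup>2"
proof -
  have \<kappa>: "0 < \<kappa>" "\<kappa> \<le> 1" and \<gamma>: "0 \<le> \<gamma>"
    using h by (auto simp: strongly_quasar_convex_def)
  have "t / (2 - \<kappa>) \<le> 1"
    using t \<kappa> by (simp add: divide_le_eq)
  then have "0 \<le> t * (1 - t / (2 - \<kappa>)) * (\<kappa> * \<gamma> / 2)"
    using t \<kappa> \<gamma> by simp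
  then have "t * (1 - t / (2 - \<kappa>)) * (\<kappa> * \<gamma> / 2) * ((sigma_min A)\<^sup>2 * (norm (x - z))\<^sup>2)
      \<le> t * (1 - t / (2 - \<kappa>)) * (\<kappa> * \<gamma> / 2) * (norm (A x - A z))\<^sup>2"
    using sigma_min_le_norm[OF A x] by (intro mult_left_mono) (simp_all add: linear_diff[OF A])
  moreover have "h (t *\<^sub>R A z + (1 - t) *\<^sub>R A x)
      \<le> \<kappa> * t * h (A z) + (1 - \<kappa> * t) * h (A x)
         - t * (1 - t / (2 - \<kappa>)) * (\<kappa> * \<gamma> / 2) * (norm (A x - A z))\<^sup>2"
    using h t unfolding strongly_quasar_convex_def by blast
  moreover have "A (t *\<^sub>R z + (1 - t) *\<^sub>R x) = t *\<^sub>R A z + (1 - t) *\<^sub>R A x"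
    by (simp add: linear_add[OF A] linear_scale[OF A])
  moreover have "t * (1 - t / (2 - \<kappa>)) * (\<kappa> * \<gamma> / 2) * ((sigma_min A)\<^sup>2 * (norm (x - z))\<^sup>2)
      = t * (1 - t / (2 - \<kappa>)) * (\<kappa> * \<gamma> * (sigma_min A)\<^sup>2 / 2) * (norm (x - z))\<^sup>2"
    by simp
  ultimately show ?thesis by (simp only:)
qed

theorem proposition21:
  fixes h :: "real ^ 'm \<Rightarrow> real"
    and A :: "real ^ 'n \<Rightarrow> real ^ 'm"
    and g :: "real ^ 'n \<Rightarrow> real"
    and ybar :: "real ^ 'm"
    and \<kappa> \<gamma> :: real
  assumes "0 < \<kappa>" and "\<kappa> \<le> 1" and "0 \<le> \<gamma>"
    and "strongly_quasar_convex \<kappa> \<gamma> h ybar"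
    and "linear A"
    and "g = h \<circ> A"
  shows "ybar \<in> range A \<longrightarrow>
    (\<exists>xbar. A xbar = ybar \<and>
       (\<forall>x \<in> (+) xbar ` range (adjoint A). \<forall>t\<in>{0..1}.
          g (t *\<^sub>R xbar + (1 - t) *\<^sub>R x)
            \<le> \<kappa> * t * g xbar + (1 - \<kappa> * t) * g x
               - t * (1 - t / (2 - \<kappa>)) * (\<kappa> * \<gamma> * (sigma_min A)\<^sup>2 / 2) * (norm (x - xbar))\<^sup>2) \<and>
       (rank (matrix A) = CARD('n) \<longrightarrow>
          strongly_quasar_convex \<kappa> (\<gamma> * (sigma_min A)\<^sup>2) g xbar))"
proof
  assume "ybar \<in> range A"
  then obtain z where z: "A z = ybar" by auto
  have ineq: "g (t *\<^sub>R z + (1 - t) *\<^sub>R x)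
      \<le> \<kappa> * t * g z + (1 - \<kappa> * t) * g x
         - t * (1 - t / (2 - \<kappa>)) * (\<kappa> * \<gamma> * (sigma_min A)\<^sup>2 / 2) * (norm (x - z))\<^sup>2"
    if "x - z \<in> range (adjoint A)" "t \<in> {0..1}" for x t
    using strongly_quasar_convex_compose_linear[OF _ assms(5) that, of \<kappa> \<gamma> h] assms(4,6) z
    by simp
  have "strongly_quasar_convex \<kappa> (\<gamma> * (sigma_min A)\<^sup>2) g z"
    if rank: "rank (matrix A) = CARD('n)"
  proof -
    have "x - z \<in> range (adjoint A)" for x
      using surj_adjoint_if_full_column_rank[OF assms(5) rank] by simp
    moreover have "is_arg_min g (\<lambda>_. True) z"
      using assms(4,6) z by (simp add: strongly_quasar_convex_def is_arg_min_def)
    ultimately show ?thesis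
      using ineq assms(1-3) by (simp add: strongly_quasar_convex_def mult.assoc)
  qed
  moreover have "x - z \<in> range (adjoint A)" if "x \<in> (+) z ` range (adjoint A)" for x
    using that by auto
  ultimately show "\<exists>xbar. A xbar = ybar \<and>
       (\<forall>x \<in> (+) xbar ` range (adjoint A). \<forall>t\<in>{0..1}.
          g (t *\<^sub>R xbar + (1 - t) *\<^sub>R x)
            \<le> \<kappa> * t * g xbar + (1 - \<kappa> * t) * g x
               - t * (1 - t / (2 - \<kappa>)) * (\<kappa> * \<gamma> * (sigma_min A)\<^sup>2 / 2) * (norm (x - xbar))\<^sup>2) \<and>
       (rank (matrix A) = CARD('n) \<longrightarrow>
          strongly_quasar_convex \<kappa> (\<gamma> * (sigma_min A)\<^sup>2) g xbar)"
    using z ineq by blast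
qed

end
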